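(* Let $\mathcal{M}$ be a $d$-dimensional, complete and connected Riemannian manifold, let $f\in\mathcal{C}^1_{dir}(\mathcal{M})$, let $x\in\mathcal{M}$, and let $(U,\varphi)$ be a chart around $x$. Then for every $\xi\in T_x\mathcal{M}$, $$f'(x;\xi)=(f\circ\varphi^{-1})'\bigl(\varphi(x);\mathrm{D}\varphi(x)[\xi]\bigr),$$ and this equality is independent of the choice of chart $(U,\varphi)$ around $x$.
   Context: The directional derivative of $f:\mathcal{M}\to\mathbb{R}$ at $x$ in the direction $\xi\in T_x\mathcal{M}$ is $f'(x;\xi)=\lim_{t\to0^+}\frac{f(\gamma(t))-f(x)}{t}$, where $\gamma:\mathbb{R}\to\mathcal{M}$ is a smooth curve with $\gamma(0)=x$ and $\gamma'(0)=\xi$; the convention is that distinct such curves yield the same value. $\mathcal{C}^1_{dir}(\mathcal{M})$ is the set of functions $f:\mathcal{M}\to\mathbb{R}$ for which $f'(x;\xi)$ exists for all $x\in\mathcal{M}$ and all $\xi\in T_x\mathcal{M}$. On the right-hand side, $(f\circ\varphi^{-1})'(\hat x;v)=\lim_{t\to0^+}\frac{f\circ\varphi^{-1}(\hat x+tv)-f\circ\varphi^{-1}(\hat x)}{t}$ is the usual directional derivative on the open set $\varphi(U)\subset\mathbb{R}^d$. *)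

theory Defs
  imports "HOL-Analysis.Analysis"
begin

text \<open>
  For an open set \<open>S\<close> of a finite-dimensional space, \<open>Ck_on k S f\<close> says that all iterated
  directional derivatives of \<open>f\<close> up to order \<open>k\<close> exist (as Frechet derivatives) and are continuous
  on \<open>S\<close>, i.e. that \<open>f\<close> is of class \<open>C^k\<close> there.  Iterating directional derivatives keeps the
  codomain fixed, which the recursion needs.
\<close>

primrec Ck_on ::
    "nat \<Rightarrow> 'a::euclidean_space set \<Rightarrow> ('a \<Rightarrow> 'b::real_normed_vector) \<Rightarrow> bool" where
  "Ck_on 0 S f \<longleftrightarrow> continuous_on S f"
| "Ck_on (Suc k) S f \<longleftrightarrow>
     (\<forall>x\<in>S. f differentiable (at x)) \<and>
     (\<forall>v. Ck_on k S (\<lambda>x. frechet_derivative f (at x) v))"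

definition smooth_on :: "'a::euclidean_space set \<Rightarrow> ('a \<Rightarrow> 'b::real_normed_vector) \<Rightarrow> bool" where
  "smooth_on S f \<longleftrightarrow> (\<forall>k. Ck_on k S f)"

subsection \<open>Smooth manifolds\<close>

type_synonym ('a, 'd) chart = "'a set \<times> ('a \<Rightarrow> real ^ 'd)"

text \<open>
  The map of a chart \<open>(U, \<phi>)\<close> is a total function; only its restriction to \<open>U\<close> matters, and
  \<open>inv_into U \<phi>\<close> is the inverse of that restriction.
\<close>

definition is_chart :: "'a topology \<Rightarrow> ('a, 'd::finite) chart \<Rightarrow> bool" where
  "is_chart X = (\<lambda>(U, \<phi>). openin X U \<and> open (\<phi> ` U) \<and>
     homeomorphic_map (subtopology X U) (top_of_set (\<phi> ` U)) \<phi>)"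

definition smooth_transition :: "('a, 'd::finite) chart \<Rightarrow> ('a, 'd) chart \<Rightarrow> bool" where
  "smooth_transition = (\<lambda>(U, \<phi>) (V, \<psi>). smooth_on (\<phi> ` (U \<inter> V)) (\<psi> \<circ> inv_into U \<phi>))"

definition compatible :: "('a, 'd::finite) chart \<Rightarrow> ('a, 'd) chart \<Rightarrow> bool" where
  "compatible c c' \<longleftrightarrow> smooth_transition c c' \<and> smooth_transition c' c"

text \<open>
  A smooth manifold modelled on \<open>real ^ 'd\<close>, of dimension \<open>CARD('d)\<close>.  The atlas \<open>A\<close> is maximal,
  so its elements are exactly the charts of the manifold.
\<close>

locale smooth_manifold =
  fixes X :: "'a topology" and A :: "('a, 'd::finite) chart set"
  assumes Hausdorff: "Hausdorff_space X"
    and second_countable: "second_countable X"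
    and charts: "c \<in> A \<Longrightarrow> is_chart X c"
    and charts_cover: "(\<Union>c\<in>A. fst c) = topspace X"
    and charts_compatible: "c \<in> A \<Longrightarrow> c' \<in> A \<Longrightarrow> compatible c c'"
    and atlas_maximal: "is_chart X c \<Longrightarrow> (\<And>c'. c' \<in> A \<Longrightarrow> compatible c c') \<Longrightarrow> c \<in> A"

subsection \<open>Curves and tangent vectors\<close>

definition smooth_curve :: "('a, 'd::finite) chart set \<Rightarrow> (real \<Rightarrow> 'a) \<Rightarrow> bool" where
  "smooth_curve A \<gamma> \<longleftrightarrow>
     (\<forall>t. \<exists>(U, \<phi>)\<in>A. \<exists>e>0. \<gamma> ` {t - e<..<t + e} \<subseteq> U \<and> smooth_on {t - e<..<t + e} (\<phi> \<circ> \<gamma>))"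

text \<open>
  A tangent vector at \<open>p\<close> is an equivalence class of smooth curves that are at \<open>p\<close> at time \<open>0\<close>;
  two curves are equivalent if they have the same derivative at \<open>0\<close> in the charts around \<open>p\<close>.
  The velocity of \<open>\<gamma>\<close> at time \<open>t\<close> is the class of the curve \<open>\<gamma>\<close> shifted by \<open>t\<close>.
\<close>

type_synonym 'a tangent = "(real \<Rightarrow> 'a) set"

definition tangent_equiv ::
    "('a, 'd::finite) chart set \<Rightarrow> (real \<Rightarrow> 'a) \<Rightarrow> (real \<Rightarrow> 'a) \<Rightarrow> bool" where
  "tangent_equiv A \<gamma> \<eta> \<longleftrightarrow> \<gamma> 0 = \<eta> 0 \<and>
     (\<forall>(U, \<phi>)\<in>A. \<gamma> 0 \<in> U \<longrightarrow>
        vector_derivative (\<phi> \<circ> \<gamma>) (at 0) = vector_derivative (\<phi> \<circ> \<eta>) (at 0))"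

definition velocity :: "('a, 'd::finite) chart set \<Rightarrow> (real \<Rightarrow> 'a) \<Rightarrow> real \<Rightarrow> 'a tangent" where
  "velocity A \<gamma> t = {\<eta>. smooth_curve A \<eta> \<and> tangent_equiv A (\<lambda>s. \<gamma> (t + s)) \<eta>}"

definition tangent_space :: "('a, 'd::finite) chart set \<Rightarrow> 'a \<Rightarrow> 'a tangent set" where
  "tangent_space A p = {velocity A \<gamma> 0 |\<gamma>. smooth_curve A \<gamma> \<and> \<gamma> 0 = p}"

text \<open>
  The differential of a chart map applied to a tangent vector \<open>\<xi>\<close>; the base point is not an
  argument because \<open>\<xi>\<close> determines it.
\<close>

definition differential :: "('a \<Rightarrow> real ^ 'd) \<Rightarrow> 'a tangent \<Rightarrow> real ^ 'd::finite" where
  "differential \<phi> \<xi> = (THE v. \<forall>\<gamma>\<in>\<xi>. ((\<phi> \<circ> \<gamma>) has_vector_derivative v) (at 0))"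

definition tangent_zero :: "('a, 'd::finite) chart set \<Rightarrow> 'a \<Rightarrow> 'a tangent" where
  "tangent_zero A p = velocity A (\<lambda>t. p) 0"

definition tangent_add ::
    "('a, 'd::finite) chart set \<Rightarrow> 'a \<Rightarrow> 'a tangent \<Rightarrow> 'a tangent \<Rightarrow> 'a tangent" where
  "tangent_add A p \<xi> \<eta> = (THE \<zeta>. \<zeta> \<in> tangent_space A p \<and>
     (\<forall>(U, \<phi>)\<in>A. p \<in> U \<longrightarrow> differential \<phi> \<zeta> = differential \<phi> \<xi> + differential \<phi> \<eta>))"

definition tangent_scale ::
    "('a, 'd::finite) chart set \<Rightarrow> 'a \<Rightarrow> real \<Rightarrow> 'a tangent \<Rightarrow> 'a tangent" where
  "tangent_scale A p r \<xi> = (THE \<zeta>. \<zeta> \<in> tangent_space A p \<and>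
     (\<forall>(U, \<phi>)\<in>A. p \<in> U \<longrightarrow> differential \<phi> \<zeta> = r *\<^sub>R differential \<phi> \<xi>))"

definition coordinate_vector ::
    "('a, 'd::finite) chart set \<Rightarrow> ('a \<Rightarrow> real ^ 'd) \<Rightarrow> 'a \<Rightarrow> 'd \<Rightarrow> 'a tangent" where
  "coordinate_vector A \<phi> p i =
     (THE \<zeta>. \<zeta> \<in> tangent_space A p \<and> differential \<phi> \<zeta> = axis i 1)"

subsection \<open>Riemannian manifolds\<close>

locale riemannian_manifold = smooth_manifold X A
  for X :: "'a topology" and A :: "('a, 'd::finite) chart set" +
  fixes g :: "'a \<Rightarrow> 'a tangent \<Rightarrow> 'a tangent \<Rightarrow> real"
  assumes metric_sym:
      "\<lbrakk>p \<in> topspace X; \<xi> \<in> tangent_space A p; \<eta> \<in> tangent_space A p\<rbrakk> \<Longrightarrow> g p \<xi> \<eta> = g p \<eta> \<xi>"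
    and metric_add:
      "\<lbrakk>p \<in> topspace X; \<xi> \<in> tangent_space A p; \<eta> \<in> tangent_space A p; \<zeta> \<in> tangent_space A p\<rbrakk>
        \<Longrightarrow> g p (tangent_add A p \<xi> \<eta>) \<zeta> = g p \<xi> \<zeta> + g p \<eta> \<zeta>"
    and metric_scale:
      "\<lbrakk>p \<in> topspace X; \<xi> \<in> tangent_space A p; \<zeta> \<in> tangent_space A p\<rbrakk>
        \<Longrightarrow> g p (tangent_scale A p r \<xi>) \<zeta> = r * g p \<xi> \<zeta>"
    and metric_pos:
      "\<lbrakk>p \<in> topspace X; \<xi> \<in> tangent_space A p; \<xi> \<noteq> tangent_zero A p\<rbrakk> \<Longrightarrow> g p \<xi> \<xi> > 0"
    and metric_smooth:
      "(U, \<phi>) \<in> A \<Longrightarrow> smooth_on (\<phi> ` U)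
        (\<lambda>y. let p = inv_into U \<phi> y in g p (coordinate_vector A \<phi> p i) (coordinate_vector A \<phi> p j))"

definition curve_length ::
    "('a, 'd::finite) chart set \<Rightarrow> ('a \<Rightarrow> 'a tangent \<Rightarrow> 'a tangent \<Rightarrow> real) \<Rightarrow> (real \<Rightarrow> 'a) \<Rightarrow> real" where
  "curve_length A g \<gamma> =
     integral {0..1} (\<lambda>t. sqrt (g (\<gamma> t) (velocity A \<gamma> t) (velocity A \<gamma> t)))"

text \<open>
  The Riemannian distance on a connected manifold.  Taking smooth curves on the whole line (which
  may have zero velocity somewhere) gives the same infimum as piecewise smooth curves on intervals,
  since each piece can be reparametrised to have all derivatives zero at its endpoints.
  The value \<open>0\<close> off the manifold suits the axioms of \<^locale>\<open>Metric_space\<close>, some of which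
  range over the whole type.
\<close>

definition riemannian_dist ::
    "'a topology \<Rightarrow> ('a, 'd::finite) chart set \<Rightarrow> ('a \<Rightarrow> 'a tangent \<Rightarrow> 'a tangent \<Rightarrow> real)
      \<Rightarrow> 'a \<Rightarrow> 'a \<Rightarrow> real" where
  "riemannian_dist X A g p q =
     (if p \<in> topspace X \<and> q \<in> topspace X
      then Inf {curve_length A g \<gamma> |\<gamma>. smooth_curve A \<gamma> \<and> \<gamma> 0 = p \<and> \<gamma> 1 = q}
      else 0)"

definition riemannian_complete ::
    "'a topology \<Rightarrow> ('a, 'd::finite) chart set \<Rightarrow> ('a \<Rightarrow> 'a tangent \<Rightarrow> 'a tangent \<Rightarrow> real) \<Rightarrow> bool" where
  "riemannian_complete X A g \<longleftrightarrow> Metric_space.mcomplete (topspace X) (riemannian_dist X A g)"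

subsection \<open>Directional derivatives\<close>

text \<open>
  On a manifold, existence of the directional derivative includes that all smooth curves with
  initial velocity \<open>\<xi>\<close> yield the same limit.
\<close>

definition has_dir_deriv ::
    "('a, 'd::finite) chart set \<Rightarrow> ('a \<Rightarrow> real) \<Rightarrow> 'a \<Rightarrow> 'a tangent \<Rightarrow> real \<Rightarrow> bool" where
  "has_dir_deriv A f x \<xi> L \<longleftrightarrow>
     (\<forall>\<gamma>. smooth_curve A \<gamma> \<and> \<gamma> 0 = x \<and> velocity A \<gamma> 0 = \<xi> \<longrightarrow>
        ((\<lambda>t. (f (\<gamma> t) - f x) / t) \<longlongrightarrow> L) (at_right 0))"

definition dir_deriv :: "('a, 'd::finite) chart set \<Rightarrow> ('a \<Rightarrow> real) \<Rightarrow> 'a \<Rightarrow> 'a tangent \<Rightarrow> real" where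
  "dir_deriv A f x \<xi> = (THE L. has_dir_deriv A f x \<xi> L)"

definition C1_dir :: "'a topology \<Rightarrow> ('a, 'd::finite) chart set \<Rightarrow> ('a \<Rightarrow> real) set" where
  "C1_dir X A =
     {f. \<forall>x\<in>topspace X. \<forall>\<xi>\<in>tangent_space A x. \<exists>L. has_dir_deriv A f x \<xi> L}"

definition has_euclidean_dir_deriv ::
    "(real ^ 'd::finite \<Rightarrow> real) \<Rightarrow> real ^ 'd \<Rightarrow> real ^ 'd \<Rightarrow> real \<Rightarrow> bool" where
  "has_euclidean_dir_deriv h y v L \<longleftrightarrow>
     ((\<lambda>t. (h (y + t *\<^sub>R v) - h y) / t) \<longlongrightarrow> L) (at_right 0)"

definition euclidean_dir_deriv ::
    "(real ^ 'd::finite \<Rightarrow> real) \<Rightarrow> real ^ 'd \<Rightarrow> real ^ 'd \<Rightarrow> real" where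
  "euclidean_dir_deriv h y v = (THE L. has_euclidean_dir_deriv h y v L)"

end

theory Submission
  imports Defs
begin

text \<open>
  In a chart \<open>(U, \<phi>)\<close> put \<open>y = \<phi> x\<close> and \<open>v = D\<phi>(x)[\<xi>]\<close>.  For small \<open>r > 0\<close> the curve
  \<open>t \<mapsto> \<phi>\<inverse> (y + r sin (t / r) v)\<close> is defined and smooth on the whole line (its
  coordinates oscillate on a short segment, so no cut-off function is needed) and has velocity \<open>\<xi>\<close>
  at \<open>0\<close>.  Hence \<open>f'(x; \<xi>)\<close> can be computed along it, and the substitution \<open>s = r sin (t / r)\<close>,
  under which \<open>t / s \<rightarrow> 1\<close>, turns the difference quotient into that of \<open>f \<circ> \<phi>\<inverse>\<close> along the
  straight line.  Independence of the chart follows, as the left-hand side does not involve it.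
\<close>

section \<open>Smoothness of the oscillating segment\<close>

text \<open>The phase \<open>d\<close> closes the family under differentiation: cosine is sine
  shifted by \<open>pi / 2\<close>, so each directional derivative has the same form with
  \<open>p\<close> replaced by 0 and \<open>v\<close> rescaled. Hence the induction over arbitrary
  \<open>p\<close>, \<open>d\<close> and \<open>v\<close>.\<close>

lemma Ck_on_sin_line:
  fixes p v :: "'b::real_normed_vector" and c d :: real
  shows "Ck_on k S (\<lambda>t. p + sin (c * t + d) *\<^sub>R v)"
proof (induction k arbitrary: p d v)
  case 0
  show ?case by (simp, intro continuous_intros)
next
  case (Suc k)
  have deriv: "((\<lambda>t. p + sin (c * t + d) *\<^sub>R v) has_derivative
      (\<lambda>w. (w * c * cos (c * t + d)) *\<^sub>R v)) (at t)" for t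
    by (auto intro!: derivative_eq_intros)
  have "frechet_derivative (\<lambda>t. p + sin (c * t + d) *\<^sub>R v) (at t) w
      = 0 + sin (c * t + (d + pi / 2)) *\<^sub>R ((w * c) *\<^sub>R v)" for t w
  proof -
    have "sin (c * t + (d + pi / 2)) = cos (c * t + d)"
      by (simp add: sin_add flip: add.assoc)
    then show ?thesis
      by (simp flip: frechet_derivative_at[OF deriv])
  qed
  then show ?case
    using Suc.IH[of 0 "d + pi / 2"] differentiableI[OF deriv] by (simp del: scaleR_scaleR)
qed

lemma smooth_on_sin_line:
  "smooth_on S (\<lambda>t::real. p + (r * sin (t / r)) *\<^sub>R v)"
  unfolding smooth_on_def
  using Ck_on_sin_line[of _ S p "1 / r" 0 "r *\<^sub>R v"] by (simp add: mult.commute)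

lemma smooth_on_differentiable: "smooth_on S f \<Longrightarrow> x \<in> S \<Longrightarrow> f differentiable (at x)"
  unfolding smooth_on_def by (metis Ck_on.simps(2))

section \<open>One-sided derivatives in Euclidean space\<close>

lemma has_euclidean_dir_deriv_reparametrize:
  assumes r: "r > 0"
    and L: "((\<lambda>t. (h (y + (r * sin (t / r)) *\<^sub>R v) - h y) / t) \<longlongrightarrow> L) (at_right 0)"
  shows "has_euclidean_dir_deriv h y v L"
proof -
  \<comment> \<open>The inverse of \<open>r * sin (t / r)\<close> near 0: the time at which the
    oscillation reaches \<open>s\<close>.\<close>
  define k where "k s = r * arcsin (s / r)" for s
  have k': "(k has_real_derivative 1) (at 0)"
    unfolding k_def using r by (auto intro!: derivative_eq_intros)
  have quot: "((\<lambda>s. k s / s) \<longlongrightarrow> 1) (at_right 0)"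
    using k' unfolding has_field_derivative_iff
    by (auto simp: k_def intro: tendsto_mono[OF at_le])
  have small: "\<forall>\<^sub>F s in at_right 0. 0 < s \<and> s < r"
    using r by (simp add: eventually_at_right_less eventually_at_right_field eventually_conj)
       (use r in blast)
  have pos: "k s > 0" and inv: "r * sin (k s / r) = s" if "0 < s" "s < r" for s
  proof -
    have "0 < s / r" "s / r \<le> 1"
      using that r by auto
    then show "k s > 0" "r * sin (k s / r) = s"
      using r arcsin_less_arcsin[of 0 "s / r"] by (simp_all add: k_def)
  qed
  have "(k \<longlongrightarrow> 0) (at_right 0)"
    using DERIV_isCont[OF k'] unfolding isCont_def
    by (auto simp: k_def intro: tendsto_mono[OF at_le])
  \<comment> \<open>Positivity of \<open>k\<close> is needed because the limit \<open>L\<close> is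
    only one-sided.\<close>
  then have lim: "filterlim k (at_right 0) (at_right 0)"
    unfolding filterlim_at using small by (auto elim!: eventually_mono dest: pos)
  have "((\<lambda>s. (h (y + (r * sin (k s / r)) *\<^sub>R v) - h y) / k s * (k s / s)) \<longlongrightarrow> L * 1) (at_right 0)"
    by (intro tendsto_mult quot filterlim_compose[OF L lim])
  moreover have "\<forall>\<^sub>F s in at_right 0.
      (h (y + (r * sin (k s / r)) *\<^sub>R v) - h y) / k s * (k s / s) = (h (y + s *\<^sub>R v) - h y) / s"
    using small by eventually_elim (use inv pos in fastforce)
  ultimately have "((\<lambda>s. (h (y + s *\<^sub>R v) - h y) / s) \<longlongrightarrow> L * 1) (at_right 0)"
    by (rule Lim_transform_eventually)
  then show ?thesis
    by (simp add: has_euclidean_dir_deriv_def)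
qed

lemma euclidean_dir_deriv_eq: "has_euclidean_dir_deriv h y v L \<Longrightarrow> euclidean_dir_deriv h y v = L"
  unfolding euclidean_dir_deriv_def has_euclidean_dir_deriv_def
  by (blast intro: tendsto_unique[OF trivial_limit_at_right_real])

lemma velocity_self: "smooth_curve A \<gamma> \<Longrightarrow> \<gamma> \<in> velocity A \<gamma> 0"
  by (simp add: velocity_def tangent_equiv_def)

lemma velocity_eqI: "tangent_equiv A \<gamma> \<eta> \<Longrightarrow> velocity A \<gamma> 0 = velocity A \<eta> 0"
  unfolding velocity_def tangent_equiv_def by fastforce

section \<open>Curves and velocities in different charts\<close>

context smooth_manifold
begin

lemma chart_inj_on:
  assumes "(U, \<phi>) \<in> A"
  shows "inj_on \<phi> U"
proof -
  have "U \<subseteq> topspace X" and "homeomorphic_map (subtopology X U) (top_of_set (\<phi> ` U)) \<phi>"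
    using charts[OF assms] openin_subset by (auto simp: is_chart_def)
  then show ?thesis
    using homeomorphic_imp_injective_map topspace_subtopology_subset by metis
qed

lemma chart_open_image: "(U, \<phi>) \<in> A \<Longrightarrow> open (\<phi> ` U)"
  using charts[of "(U, \<phi>)"] by (simp add: is_chart_def)

lemma chart_open_image_Int:
  assumes "(U, \<phi>) \<in> A" "(V, \<psi>) \<in> A"
  shows "open (\<phi> ` (U \<inter> V))"
proof -
  have "openin X V" and hom: "homeomorphic_map (subtopology X U) (top_of_set (\<phi> ` U)) \<phi>"
    using assms charts[of "(U, \<phi>)"] charts[of "(V, \<psi>)"] by (auto simp: is_chart_def)
  then have "openin (subtopology X U) (U \<inter> V)"
    by (simp add: openin_subtopology_Int2)
  then have "openin (top_of_set (\<phi> ` U)) (\<phi> ` (U \<inter> V))"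
    using homeomorphic_imp_open_map[OF hom] by (simp add: open_map_def)
  then show ?thesis
    using chart_open_image[OF assms(1)] openin_open_trans by blast
qed

lemma transition_differentiable:
  assumes "(U, \<phi>) \<in> A" "(V, \<psi>) \<in> A" "x \<in> U" "x \<in> V"
  shows "(\<psi> \<circ> inv_into U \<phi>) differentiable (at (\<phi> x))"
  using charts_compatible[OF assms(1,2)] assms(3,4)
  by (auto simp: compatible_def smooth_transition_def intro: smooth_on_differentiable)

text \<open>Chain rule for the transition map applied to \<open>\<phi> \<circ> \<gamma>\<close>.
  This composition agrees with \<open>\<psi> \<circ> \<gamma>\<close> only while the curve is in
  \<open>U\<close>, hence the eventual condition.\<close>

lemma has_vector_derivative_chart_change:
  assumes U: "(U, \<phi>) \<in> A" and V: "(V, \<psi>) \<in> A" and "\<gamma> 0 \<in> U" "\<gamma> 0 \<in> V"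
    and ev: "\<forall>\<^sub>F t in at 0. \<gamma> t \<in> U"
    and v: "((\<phi> \<circ> \<gamma>) has_vector_derivative v) (at 0)"
  shows "((\<psi> \<circ> \<gamma>) has_vector_derivative
      frechet_derivative (\<psi> \<circ> inv_into U \<phi>) (at (\<phi> (\<gamma> 0))) v) (at 0)"
proof -
  let ?T = "\<psi> \<circ> inv_into U \<phi>" and ?D = "frechet_derivative (\<psi> \<circ> inv_into U \<phi>) (at (\<phi> (\<gamma> 0)))"
  have T: "(?T has_derivative ?D) (at (\<phi> (\<gamma> 0)))"
    using transition_differentiable[OF U V assms(3,4)] frechet_derivative_works by blast
  have "((?T \<circ> (\<phi> \<circ> \<gamma>)) has_derivative (?D \<circ> (\<lambda>t. t *\<^sub>R v))) (at 0)"
    using v T by (intro diff_chain_at) (auto simp: has_vector_derivative_def)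
  then have "((?T \<circ> (\<phi> \<circ> \<gamma>)) has_vector_derivative ?D v) (at 0)"
    by (simp only: has_vector_derivative_def linear_scale[OF has_derivative_linear[OF T]] o_def[of ?D])
  moreover have "\<forall>\<^sub>F t in at 0. (?T \<circ> (\<phi> \<circ> \<gamma>)) t = (\<psi> \<circ> \<gamma>) t"
    using ev by eventually_elim (simp add: inv_into_f_f[OF chart_inj_on[OF U]])
  moreover have "(?T \<circ> (\<phi> \<circ> \<gamma>)) 0 = (\<psi> \<circ> \<gamma>) 0"
    using assms(3) by (simp add: inv_into_f_f[OF chart_inj_on[OF U]])
  ultimately show ?thesis
    unfolding has_vector_derivative_def by (rule has_derivative_transform_eventually) simp
qed

text \<open>A smooth curve comes with only some chart around each of its points. Continuity there
  and openness of the overlap keep the curve in \<open>U\<close> near time 0; the change of charts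
  then gives differentiability.\<close>

lemma smooth_curve_in_chart:
  assumes \<gamma>: "smooth_curve A \<gamma>" and U: "(U, \<phi>) \<in> A" and "\<gamma> 0 \<in> U"
  shows "\<forall>\<^sub>F t in at 0. \<gamma> t \<in> U" and "(\<phi> \<circ> \<gamma>) differentiable (at 0)"
proof -
  obtain W \<kappa> e where W: "(W, \<kappa>) \<in> A" and "e > 0"
    and sub: "\<gamma> ` {-e<..<e} \<subseteq> W" and smooth: "smooth_on {-e<..<e} (\<kappa> \<circ> \<gamma>)"
    using \<gamma>[unfolded smooth_curve_def, rule_format, of 0] by auto
  have near: "\<forall>\<^sub>F t in at 0. \<gamma> t \<in> W"
    using sub \<open>e > 0\<close> by (force simp: eventually_at dist_real_def intro!: exI[of _ e])
  have "\<gamma> 0 \<in> W"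
    using sub \<open>e > 0\<close> by auto
  have diff: "(\<kappa> \<circ> \<gamma>) differentiable (at 0)"
    using smooth \<open>e > 0\<close> by (auto intro: smooth_on_differentiable)
  have "\<forall>\<^sub>F t in at 0. (\<kappa> \<circ> \<gamma>) t \<in> \<kappa> ` (W \<inter> U)"
    using differentiable_imp_continuous_within[OF diff] \<open>\<gamma> 0 \<in> W\<close> \<open>\<gamma> 0 \<in> U\<close>
    by (intro topological_tendstoD chart_open_image_Int[OF W U])
      (auto simp: continuous_within o_def)
  then show "\<forall>\<^sub>F t in at 0. \<gamma> t \<in> U"
    \<comment> \<open>Injectivity of \<open>\<kappa>\<close> on \<open>W\<close> turns membership in
      the image of the overlap into membership in \<open>U\<close>.\<close>
    using near by eventually_elim (use chart_inj_on[OF W] in \<open>auto dest: inj_onD\<close>)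
  show "(\<phi> \<circ> \<gamma>) differentiable (at 0)"
    using has_vector_derivative_chart_change[OF W U \<open>\<gamma> 0 \<in> W\<close> \<open>\<gamma> 0 \<in> U\<close> near]
      diff vector_derivative_works differentiableI_vector by blast
qed

text \<open>All curves in the class share one derivative in the chart, which gives existence for
  \<open>THE\<close>; uniqueness holds because \<open>\<gamma>\<close> itself is in the
  class.\<close>

lemma differential_velocity:
  assumes \<gamma>: "smooth_curve A \<gamma>" and U: "(U, \<phi>) \<in> A" and "\<gamma> 0 \<in> U"
  shows "differential \<phi> (velocity A \<gamma> 0) = vector_derivative (\<phi> \<circ> \<gamma>) (at 0)"
  unfolding differential_def
proof (rule the_equality)
  show "\<forall>\<eta>\<in>velocity A \<gamma> 0.
      ((\<phi> \<circ> \<eta>) has_vector_derivative vector_derivative (\<phi> \<circ> \<gamma>) (at 0)) (at 0)"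
  proof
    fix \<eta> assume "\<eta> \<in> velocity A \<gamma> 0"
    then have "smooth_curve A \<eta>" "\<eta> 0 = \<gamma> 0"
      and "vector_derivative (\<phi> \<circ> \<gamma>) (at 0) = vector_derivative (\<phi> \<circ> \<eta>) (at 0)"
      using U \<open>\<gamma> 0 \<in> U\<close> by (auto simp: velocity_def tangent_equiv_def)
    then show "((\<phi> \<circ> \<eta>) has_vector_derivative vector_derivative (\<phi> \<circ> \<gamma>) (at 0)) (at 0)"
      using smooth_curve_in_chart(2)[OF _ U] \<open>\<gamma> 0 \<in> U\<close> vector_derivative_works by metis
  qed
next
  fix v assume "\<forall>\<eta>\<in>velocity A \<gamma> 0. ((\<phi> \<circ> \<eta>) has_vector_derivative v) (at 0)"
  then show "v = vector_derivative (\<phi> \<circ> \<gamma>) (at 0)"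
    using velocity_self[OF \<gamma>] vector_derivative_at by metis
qed

text \<open>Agreement in one chart suffices: the derivative of the transition map at the common
  point carries it to every other chart.\<close>

lemma tangent_equivI_chart:
  assumes \<gamma>: "smooth_curve A \<gamma>" and \<eta>: "smooth_curve A \<eta>" and U: "(U, \<phi>) \<in> A"
    and "\<gamma> 0 \<in> U" and eq: "\<gamma> 0 = \<eta> 0"
    and deriv: "vector_derivative (\<phi> \<circ> \<gamma>) (at 0) = vector_derivative (\<phi> \<circ> \<eta>) (at 0)"
  shows "tangent_equiv A \<gamma> \<eta>"
proof -
  have "vector_derivative (\<psi> \<circ> \<gamma>) (at 0) = vector_derivative (\<psi> \<circ> \<eta>) (at 0)"
    if V: "(V, \<psi>) \<in> A" "\<gamma> 0 \<in> V" for V \<psi>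
  proof -
    have "vector_derivative (\<psi> \<circ> \<zeta>) (at 0) =
        frechet_derivative (\<psi> \<circ> inv_into U \<phi>) (at (\<phi> (\<zeta> 0))) (vector_derivative (\<phi> \<circ> \<zeta>) (at 0))"
      if \<zeta>: "smooth_curve A \<zeta>" and "\<zeta> 0 = \<gamma> 0" for \<zeta>
      using smooth_curve_in_chart[OF \<zeta> U] V that \<open>\<gamma> 0 \<in> U\<close>
      by (intro vector_derivative_at has_vector_derivative_chart_change[OF U])
        (auto simp: vector_derivative_works)
    then show ?thesis
      using \<gamma> \<eta> eq deriv by simp
  qed
  then show ?thesis
    using eq by (auto simp: tangent_equiv_def)
qed

section \<open>Comparison of the two directional derivatives\<close>

lemma has_euclidean_dir_deriv_in_chart:
  assumes U: "(U, \<phi>) \<in> A" and "x \<in> U" and \<xi>: "\<xi> \<in> tangent_space A x"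
    and L: "has_dir_deriv A f x \<xi> L"
  shows "has_euclidean_dir_deriv (f \<circ> inv_into U \<phi>) (\<phi> x) (differential \<phi> \<xi>) L"
proof -
  obtain \<gamma> where \<gamma>: "smooth_curve A \<gamma>" "\<gamma> 0 = x" and \<xi>_eq: "\<xi> = velocity A \<gamma> 0"
    using \<xi> by (auto simp: tangent_space_def)
  define v where "v = differential \<phi> \<xi>"
  have v: "v = vector_derivative (\<phi> \<circ> \<gamma>) (at 0)"
    unfolding v_def \<xi>_eq using \<gamma> \<open>x \<in> U\<close> differential_velocity[OF _ U] by simp
  have "\<phi> x \<in> \<phi> ` U"
    using \<open>x \<in> U\<close> by simp
  then obtain d where "d > 0" and d: "ball (\<phi> x) d \<subseteq> \<phi> ` U"
    using chart_open_image[OF U] open_contains_ball by metis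
  \<comment> \<open>The displacement is at most \<open>r * norm v < d\<close>, so the segment stays
    in the ball; the summand 1 covers \<open>v = 0\<close>.\<close>
  define r where "r = d / (norm v + 1)"
  have "r > 0"
    using \<open>d > 0\<close> by (simp add: r_def add_nonneg_pos)
  define \<sigma> where "\<sigma> t = \<phi> x + (r * sin (t / r)) *\<^sub>R v" for t
  define \<eta> where "\<eta> = inv_into U \<phi> \<circ> \<sigma>"
  have \<sigma>_in: "\<sigma> t \<in> \<phi> ` U" for t
  proof -
    have "norm ((r * sin (t / r)) *\<^sub>R v) \<le> r * norm v"
      using \<open>r > 0\<close> abs_sin_le_one[of "t / r"]
      by (simp add: abs_mult mult_left_le mult_right_mono)
    also have "\<dots> < r * (norm v + 1)"
      using \<open>r > 0\<close> by simp
    also have "\<dots> = d"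
      using norm_ge_zero[of v] by (simp add: r_def del: norm_ge_zero)
    finally show ?thesis
      using d by (auto simp: \<sigma>_def dist_norm)
  qed
  have \<phi>\<eta>: "\<phi> \<circ> \<eta> = \<sigma>"
    using \<sigma>_in by (simp add: \<eta>_def fun_eq_iff f_inv_into_f)
  have \<eta>: "smooth_curve A \<eta>"
    unfolding smooth_curve_def
  proof
    fix t
    show "\<exists>(U, \<phi>)\<in>A. \<exists>e>0. \<eta> ` {t - e<..<t + e} \<subseteq> U \<and> smooth_on {t - e<..<t + e} (\<phi> \<circ> \<eta>)"
    \<comment> \<open>As \<open>\<sigma>\<close> never leaves the chart image, one chart serves all
      times and any radius works, here 1.\<close>
    proof (rule bexI[OF _ U], simp only: case_prod_conv \<phi>\<eta>, intro exI[of _ 1] conjI)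
      show "\<eta> ` {t - 1<..<t + 1} \<subseteq> U"
        using \<sigma>_in by (auto simp: \<eta>_def inv_into_into)
      show "smooth_on {t - 1<..<t + 1} \<sigma>"
        unfolding \<sigma>_def by (rule smooth_on_sin_line)
    qed simp
  qed
  have \<eta>0: "\<eta> 0 = x"
    using \<open>x \<in> U\<close> by (simp add: \<eta>_def \<sigma>_def inv_into_f_f[OF chart_inj_on[OF U]])
  have "(\<sigma> has_vector_derivative v) (at 0)"
    unfolding \<sigma>_def has_vector_derivative_def using \<open>r > 0\<close>
    by (auto intro!: derivative_eq_intros)
  \<comment> \<open>In the chart, \<open>\<eta>\<close> and \<open>\<gamma>\<close> both have
    derivative \<open>v\<close> at 0, so they represent the same tangent vector.\<close>
  then have "velocity A \<eta> 0 = \<xi>"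
    unfolding \<xi>_eq using \<gamma> \<eta> \<eta>0 \<open>x \<in> U\<close> v
    by (intro velocity_eqI tangent_equivI_chart[OF _ _ U]) (auto simp: \<phi>\<eta> vector_derivative_at)
  then have "((\<lambda>t. (f (\<eta> t) - f x) / t) \<longlongrightarrow> L) (at_right 0)"
    using L \<eta> \<eta>0 by (simp add: has_dir_deriv_def)
  then have "((\<lambda>t. ((f \<circ> inv_into U \<phi>) (\<phi> x + (r * sin (t / r)) *\<^sub>R v)
      - (f \<circ> inv_into U \<phi>) (\<phi> x)) / t) \<longlongrightarrow> L) (at_right 0)"
    using \<open>x \<in> U\<close> by (simp add: \<eta>_def \<sigma>_def inv_into_f_f[OF chart_inj_on[OF U]])
  then show ?thesis
    unfolding v_def[symmetric] by (rule has_euclidean_dir_deriv_reparametrize[OF \<open>r > 0\<close>])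
qed

end

text \<open>Membership in the tangent space provides a curve with velocity \<open>\<xi>\<close>, and
  limits along it are unique. Without such a curve \<open>has_dir_deriv\<close> would hold vacuously
  for every value.\<close>

lemma dir_deriv_eq:
  assumes "\<xi> \<in> tangent_space A x" and L: "has_dir_deriv A f x \<xi> L"
  shows "dir_deriv A f x \<xi> = L"
proof -
  obtain \<gamma> where "smooth_curve A \<gamma>" "\<gamma> 0 = x" "velocity A \<gamma> 0 = \<xi>"
    using assms(1) by (auto simp: tangent_space_def)
  then have "M = L" if "has_dir_deriv A f x \<xi> M" for M
    using L that unfolding has_dir_deriv_def
    by (blast intro: tendsto_unique[OF trivial_limit_at_right_real])
  then show ?thesis
    unfolding dir_deriv_def using L by blast
qed

text \<open>Since \<open>euclidean_dir_deriv\<close> is a \<open>THE\<close> term, the existence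
  conjunct is what makes the equation speak of an actual limit.\<close>

theorem proposition3p1:
  fixes X :: "'a topology"
    and A :: "('a, 'd::finite) chart set"
    and g :: "'a \<Rightarrow> 'a tangent \<Rightarrow> 'a tangent \<Rightarrow> real"
    and f :: "'a \<Rightarrow> real"
    and x :: 'a
    and U :: "'a set"
    and \<phi> :: "'a \<Rightarrow> real ^ 'd"
  assumes "riemannian_manifold X A g"
    and "riemannian_complete X A g"
    and "connected_space X"
    and "f \<in> C1_dir X A"
    and "x \<in> topspace X"
    and "(U, \<phi>) \<in> A" and "x \<in> U"
  shows "\<forall>\<xi>\<in>tangent_space A x.
    (\<exists>L. has_euclidean_dir_deriv (f \<circ> inv_into U \<phi>) (\<phi> x) (differential \<phi> \<xi>) L) \<and>
    dir_deriv A f x \<xi> =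
      euclidean_dir_deriv (f \<circ> inv_into U \<phi>) (\<phi> x) (differential \<phi> \<xi>) \<and>
    (\<forall>(V, \<psi>)\<in>A. x \<in> V \<longrightarrow>
      euclidean_dir_deriv (f \<circ> inv_into V \<psi>) (\<psi> x) (differential \<psi> \<xi>) =
      euclidean_dir_deriv (f \<circ> inv_into U \<phi>) (\<phi> x) (differential \<phi> \<xi>))"
proof
  fix \<xi> assume \<xi>: "\<xi> \<in> tangent_space A x"
  interpret riemannian_manifold X A g by fact
  obtain L where L: "has_dir_deriv A f x \<xi> L"
    using assms(4,5) \<xi> by (auto simp: C1_dir_def)
  \<comment> \<open>The value \<open>L\<close> was fixed before any chart, so it is the same for all
    of them; this is the independence claim.\<close>
  have chart: "has_euclidean_dir_deriv (f \<circ> inv_into V \<psi>) (\<psi> x) (differential \<psi> \<xi>) L"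
    if "(V, \<psi>) \<in> A" "x \<in> V" for V \<psi>
    using has_euclidean_dir_deriv_in_chart[OF that \<xi> L] .
  show "(\<exists>L. has_euclidean_dir_deriv (f \<circ> inv_into U \<phi>) (\<phi> x) (differential \<phi> \<xi>) L) \<and>
    dir_deriv A f x \<xi> =
      euclidean_dir_deriv (f \<circ> inv_into U \<phi>) (\<phi> x) (differential \<phi> \<xi>) \<and>
    (\<forall>(V, \<psi>)\<in>A. x \<in> V \<longrightarrow>
      euclidean_dir_deriv (f \<circ> inv_into V \<psi>) (\<psi> x) (differential \<psi> \<xi>) =
      euclidean_dir_deriv (f \<circ> inv_into U \<phi>) (\<phi> x) (differential \<phi> \<xi>))"
    using chart[OF assms(6,7)] euclidean_dir_deriv_eq[OF chart[OF assms(6,7)]]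
      dir_deriv_eq[OF \<xi> L] euclidean_dir_deriv_eq[OF chart] by (auto simp del: o_apply)
qed

end
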